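(* For each integer $n\ge 1$ let $C_n=\sup_{\mathcal P}\lambda(\mathcal P)$, where the supremum is over all families $\mathcal P=((x_1,y_1),\dots,(x_n,y_n))$ of $n$ pairs of points of $\mathbb{R}^2$ such that all $2n$ points are distinct and $|x_i-y_i|\le 1$ for every $i$, and where $$\lambda(\mathcal P)=\inf_{\gamma_1,\dots,\gamma_n}\max_{1\le i\le n}\operatorname{len}(\gamma_i),$$ the infimum being over all families of pairwise disjoint rectifiable simple arcs $\gamma_1,\dots,\gamma_n$ in $\mathbb{R}^2$ such that $\gamma_i$ joins $x_i$ to $y_i$ for every $i$. Then $C_{n+1}\ge C_n$ for every $n\ge 1$. In particular, $$C_3\ge C_2=\sqrt2>\frac{\sqrt3+1}{2},$$ so $C_3\ne\frac{\sqrt3+1}{2}$.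
   Context: $|\cdot|$ is the Euclidean norm on $\mathbb{R}^2$. A simple arc from $x$ to $y$ is the image of an injective continuous map $[0,1]\to\mathbb{R}^2$ sending $0$ to $x$ and $1$ to $y$; it is rectifiable if it has finite length, and $\operatorname{len}(\gamma)$ denotes the length of a rectifiable arc $\gamma$. Arcs include their endpoints, so disjointness means that the closed arcs have no point in common. Suprema are taken in the extended reals $[0,\infty]$. *)

theory Defs
  imports "HOL-Analysis.Analysis"
begin

text \<open>
  The length of a path is the supremum of the lengths of its inscribed polygons. For an injective
  path it depends only on the image, so it is the length of the arc that the path parametrizes.
\<close>

definition path_len :: "(real \<Rightarrow> 'a::metric_space) \<Rightarrow> ennreal" where
  "path_len g = (SUP (m, t) \<in> {(m :: nat, t :: nat \<Rightarrow> real). mono_on {..m} t \<and> t ` {..m} \<subseteq> {0..1}}.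
     ennreal (\<Sum>k<m. dist (g (t k)) (g (t (Suc k)))))"

definition rectifiable_path :: "(real \<Rightarrow> 'a::metric_space) \<Rightarrow> bool" where
  "rectifiable_path g \<longleftrightarrow> path_len g < \<infinity>"

text \<open>Arcs are given by injective parametrizations; only the indices in \<open>{1..n}\<close> matter.\<close>

definition linkages ::
    "nat \<Rightarrow> (nat \<Rightarrow> real^2) \<Rightarrow> (nat \<Rightarrow> real^2) \<Rightarrow> (nat \<Rightarrow> real \<Rightarrow> real^2) set" where
  "linkages n x y = {\<gamma>.
     (\<forall>i\<in>{1..n}. arc (\<gamma> i) \<and> rectifiable_path (\<gamma> i) \<and>
        pathstart (\<gamma> i) = x i \<and> pathfinish (\<gamma> i) = y i) \<and>
     disjoint_family_on (\<lambda>i. path_image (\<gamma> i)) {1..n}}"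

definition linkage_len :: "nat \<Rightarrow> (nat \<Rightarrow> real^2) \<Rightarrow> (nat \<Rightarrow> real^2) \<Rightarrow> ennreal" where
  "linkage_len n x y = (INF \<gamma> \<in> linkages n x y. Max ((\<lambda>i. path_len (\<gamma> i)) ` {1..n}))"

definition admissible_pairs :: "nat \<Rightarrow> ((nat \<Rightarrow> real^2) \<times> (nat \<Rightarrow> real^2)) set" where
  "admissible_pairs n = {(x, y).
     inj_on x {1..n} \<and> inj_on y {1..n} \<and> x ` {1..n} \<inter> y ` {1..n} = {} \<and>
     (\<forall>i\<in>{1..n}. norm (x i - y i) \<le> 1)}"

definition linkage_const :: "nat \<Rightarrow> ennreal" where
  "linkage_const n = (SUP (x, y) \<in> admissible_pairs n. linkage_len n x y)"

end

theory Submission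
  imports Defs
begin

text \<open>
  Monotonicity: add a fresh pair; a linkage of the larger family restricts to one of the smaller.

  For \<open>C\<^sub>2 \<ge> \<surd>2\<close> take the endpoints of two perpendicular unit segments that bisect each other. An arc
  of length less than \<open>\<surd>2\<close> stays inside the ellipse with foci at its endpoints, whose minor axis is the
  other segment. Prolonging both arcs to the sides of a square creates no new intersection, and
  the Fashoda theorem makes the prolonged arcs meet.

  For \<open>C\<^sub>2 \<le> \<surd>2\<close> the cases of disjoint or collinear segments are easy. Otherwise let \<open>c\<close> be a common
  point and \<open>u\<close> the endpoint nearest to \<open>c\<close>. Then \<open>u\<close> lies in the disk having the other segment \<open>pq\<close> as
  diameter, so \<open>|pu| + |uq| \<le> \<surd>2\<close>; keep the segment ending in \<open>u\<close> and join \<open>p\<close> to \<open>q\<close> through a point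
  just beyond \<open>u\<close>.
\<close>

section \<open>Lengths of paths\<close>

text \<open>The inscribed polygon with parameters \<open>0\<close>, \<open>t\<close>,
  \<open>1\<close> is one competitor in the supremum. This is what confines a short arc to an
  ellipse with foci at its endpoints.\<close>

lemma path_len_ge_dist_through:
  assumes "t \<in> {0..1}"
  shows "ennreal (dist (g 0) (g t) + dist (g t) (g 1)) \<le> path_len g"
proof -
  define s :: "nat \<Rightarrow> real" where "s k = (if k = 0 then 0 else if k = 1 then t else 1)" for k
  have "mono_on {..2} s" "s ` {..2} \<subseteq> {0..1}"
    using assms by (auto simp: s_def mono_on_def)
  moreover have "(\<Sum>k<2. dist (g (s k)) (g (s (Suc k)))) = dist (g 0) (g t) + dist (g t) (g 1)"
    by (simp add: s_def numeral_2_eq_2)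
  ultimately show ?thesis
    unfolding path_len_def by (intro SUP_upper2[where i = "(2, s)"]) auto
qed

text \<open>\<open>F\<close> acts as an arc-length function: a two-point estimate suffices, because
  its increments telescope over every partition.\<close>

lemma path_len_le_of_increments:
  fixes F :: "real \<Rightarrow> real"
  assumes "\<And>s t. 0 \<le> s \<Longrightarrow> s \<le> t \<Longrightarrow> t \<le> 1 \<Longrightarrow> dist (g s) (g t) \<le> F t - F s"
  shows "path_len g \<le> ennreal (F 1 - F 0)"
  unfolding path_len_def
proof (intro SUP_least, clarify)
  fix m :: nat and t :: "nat \<Rightarrow> real"
  assume mono: "mono_on {..m} t" and range: "t ` {..m} \<subseteq> {0..1}"
  have F_mono: "F s \<le> F t" if "0 \<le> s" "s \<le> t" "t \<le> 1" for s t
    using assms[OF that] zero_le_dist[of "g s" "g t"] by linarith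
  have bounds: "0 \<le> t k" "t k \<le> 1" if "k \<le> m" for k
    using range that by auto
  have "(\<Sum>k<m. dist (g (t k)) (g (t (Suc k)))) \<le> (\<Sum>k<m. F (t (Suc k)) - F (t k))"
    by (intro sum_mono assms bounds monotone_onD[OF mono]) auto
  also have "\<dots> = F (t m) - F (t 0)"
    by (rule sum_lessThan_telescope)
  also have "\<dots> \<le> F 1 - F 0"
    using F_mono[of "t m" 1] F_mono[of 0 "t 0"] bounds by force
  finally show "ennreal (\<Sum>k<m. dist (g (t k)) (g (t (Suc k)))) \<le> ennreal (F 1 - F 0)"
    by (rule ennreal_leI)
qed

lemma dist_linepath: "dist (linepath a b s) (linepath a b t) = \<bar>t - s\<bar> * dist a b"
proof -
  have "linepath a b s - linepath a b t = (t - s) *\<^sub>R (a - b)"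
    by (simp add: linepath_def algebra_simps)
  then show ?thesis
    by (simp add: dist_norm)
qed

lemma path_len_linepath: "path_len (linepath a b) \<le> ennreal (dist a b)"
  using path_len_le_of_increments[of "linepath a b" "\<lambda>t. t * dist a b"]
  by (simp add: dist_linepath algebra_simps)

lemma path_len_join_linepath:
  "path_len (linepath a b +++ linepath b c) \<le> ennreal (dist a b + dist b c)"
proof -
  let ?g = "linepath a b +++ linepath b c"
  \<comment> \<open>\<open>F t\<close> is the length travelled up to time \<open>t\<close>; the join
    runs through each leg at double speed.\<close>
  define F where "F t = (if t \<le> 1/2 then 2 * t * dist a b else dist a b + (2 * t - 1) * dist b c)"
    for t :: real
  have "dist (?g s) (?g t) \<le> F t - F s" if "0 \<le> s" "s \<le> t" "t \<le> 1" for s t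
  proof -
    consider "t \<le> 1/2" | "s \<le> 1/2" "1/2 < t" | "1/2 < s"
      by linarith
    then show ?thesis
    proof cases
      case 1
      then show ?thesis
        using that by (simp add: joinpaths_def F_def dist_linepath algebra_simps)
    next
      case 2
      \<comment> \<open>The two parameters lie on different legs, so the chord is compared with the
        way through the corner \<open>b\<close>.\<close>
      have "dist (?g s) (?g t) \<le> dist (?g s) b + dist b (?g t)"
        by (rule dist_triangle)
      moreover have "dist (?g s) b = (1 - 2 * s) * dist a b"
        using 2 dist_linepath[of a b "2 * s" 1]
        by (simp add: joinpaths_def linepath_1')
      moreover have "dist b (?g t) = (2 * t - 1) * dist b c"
        using 2 dist_linepath[of b c 0 "2 * t - 1"]
        by (simp add: joinpaths_def linepath_0')
      ultimately show ?thesis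
        using 2 by (simp add: F_def algebra_simps)
    next
      case 3
      then show ?thesis
        using that by (simp add: joinpaths_def F_def dist_linepath algebra_simps)
    qed
  qed
  from path_len_le_of_increments[of ?g F, OF this] show ?thesis
    by (simp add: F_def)
qed

section \<open>Monotonicity\<close>

lemma linkage_len_restrict:
  assumes "1 \<le> m" "m \<le> n" "\<And>i. i \<in> {1..m} \<Longrightarrow> x' i = x i \<and> y' i = y i"
  shows "linkage_len m x y \<le> linkage_len n x' y'"
  unfolding linkage_len_def
proof (rule INF_mono)
  fix \<gamma> assume \<gamma>: "\<gamma> \<in> linkages n x' y'"
  have sub: "{1..m} \<subseteq> {1..n}"
    using assms by auto
  have "\<gamma> \<in> linkages m x y"
    using \<gamma> sub assms(3) disjoint_family_on_mono[OF sub]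
    unfolding linkages_def by fastforce
  moreover have "Max ((\<lambda>i. path_len (\<gamma> i)) ` {1..m}) \<le> Max ((\<lambda>i. path_len (\<gamma> i)) ` {1..n})"
    using sub assms(1) by (intro Max_mono image_mono) auto
  ultimately show "\<exists>\<gamma>'\<in>linkages m x y. Max ((\<lambda>i. path_len (\<gamma>' i)) ` {1..m})
      \<le> Max ((\<lambda>i. path_len (\<gamma> i)) ` {1..n})"
    by blast
qed

lemma linkage_const_Suc_ge:
  assumes "1 \<le> n"
  shows "linkage_const n \<le> linkage_const (n + 1)"
  unfolding linkage_const_def
proof (rule SUP_mono, clarify)
  fix x y assume xy: "(x, y) \<in> admissible_pairs n"
  let ?F = "x ` {1..n} \<union> y ` {1..n}"
  \<comment> \<open>Radius \<open>1/2\<close> makes any two points of the ball an admissible pair;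
    infinitely many points leave room to avoid the old ones.\<close>
  have infinite: "infinite (ball (0::real^2) (1/2))"
    using uncountable_ball[of "1/2" "0::real^2"] countable_finite by force
  have fresh: "\<exists>z. z \<in> ball (0::real^2) (1/2) \<and> z \<notin> A" if "finite A" for A
    using infinite_imp_nonempty[OF Diff_infinite_finite[OF that infinite]] by blast
  obtain P where P: "P \<in> ball 0 (1/2)" "P \<notin> ?F"
    using fresh[of ?F] by auto
  obtain Q where Q: "Q \<in> ball 0 (1/2)" "Q \<notin> insert P ?F"
    using fresh[of "insert P ?F"] by auto
  let ?x = "x(n + 1 := P)" and ?y = "y(n + 1 := Q)"
  have "norm (P - Q) \<le> 1"
    using P(1) Q(1) norm_triangle_ineq4[of P Q] by simp
  moreover have ivl: "{1..n + 1} = insert (n + 1) {1..n}"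
    by auto
  moreover have "?x ` {1..n} = x ` {1..n}" "?y ` {1..n} = y ` {1..n}"
    by auto
  moreover have "inj_on ?x {1..n} = inj_on x {1..n}" "inj_on ?y {1..n} = inj_on y {1..n}"
    by (auto intro!: inj_on_cong)
  ultimately have "(?x, ?y) \<in> admissible_pairs (n + 1)"
    using xy P(2) Q(2) unfolding admissible_pairs_def ivl by simp
  moreover have "linkage_len n x y \<le> linkage_len (n + 1) ?x ?y"
    using assms by (intro linkage_len_restrict) auto
  ultimately show "\<exists>p\<in>admissible_pairs (n + 1). linkage_len n x y
      \<le> (case p of (x, y) \<Rightarrow> linkage_len (n + 1) x y)"
    by (intro bexI[of _ "(?x, ?y)"]) simp_all
qed

section \<open>Upper bound for two pairs\<close>

lemma linkage_len_2_le:
  assumes "arc g" "pathstart g = x 1" "pathfinish g = y 1" "path_len g \<le> ennreal r"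
    and "arc h" "pathstart h = x 2" "pathfinish h = y 2" "path_len h \<le> ennreal r"
    and "path_image g \<inter> path_image h = {}"
  shows "linkage_len 2 x y \<le> ennreal r"
proof -
  define \<gamma> where "\<gamma> i = (if i = 1 then g else h)" for i :: nat
  have ivl: "{1..2} = {1, 2::nat}"
    by auto
  have "\<gamma> \<in> linkages 2 x y"
    using assms unfolding linkages_def ivl
    by (auto simp: \<gamma>_def rectifiable_path_def disjoint_family_on_def le_less_trans[OF _ ennreal_less_top])
  then have "linkage_len 2 x y \<le> Max ((\<lambda>i. path_len (\<gamma> i)) ` {1..2})"
    unfolding linkage_len_def by (rule INF_lower)
  also have "\<dots> \<le> ennreal r"
    using assms unfolding ivl by (simp add: \<gamma>_def)
  finally show ?thesis .
qed

section \<open>Affine functions on segments, and normals in the plane\<close>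

lemma inner_closed_segment:
  assumes "z \<in> closed_segment a b"
  obtains s where "0 \<le> s" "s \<le> 1" "z = (1 - s) *\<^sub>R a + s *\<^sub>R b"
    "\<And>n u. n \<bullet> (z - u) = (1 - s) * (n \<bullet> (a - u)) + s * (n \<bullet> (b - u))"
proof -
  obtain s where s: "0 \<le> s" "s \<le> 1" "z = (1 - s) *\<^sub>R a + s *\<^sub>R b"
    using assms by (auto simp: in_segment)
  moreover have "n \<bullet> (z - u) = (1 - s) * (n \<bullet> (a - u)) + s * (n \<bullet> (b - u))" for n u
    by (simp add: s(3) inner_diff_right inner_add_right algebra_simps)
  ultimately show thesis
    using that by blast
qed

text \<open>An affine function that vanishes at \<open>b\<close> but not at \<open>a\<close> is, on
  the segment, \<open>1 - s\<close> times its value at \<open>a\<close>, so a zero forces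
  \<open>s = 1\<close>.\<close>

lemma closed_segment_off_hyperplane:
  assumes "z \<in> closed_segment a b" "n \<bullet> (b - u) = 0" "n \<bullet> (a - u) \<noteq> 0" "n \<bullet> (z - u) = 0"
  shows "z = b"
  using assms by (elim inner_closed_segment) auto

lemma arc_join_linepath:
  assumes "a \<noteq> b" "b \<noteq> c" "closed_segment a b \<inter> closed_segment b c \<subseteq> {b}"
  shows "arc (linepath a b +++ linepath b c)"
  using assms by (intro arc_join) auto

text \<open>The counterclockwise quarter turn, used as a normal of lines with direction
  \<open>w\<close>; \<open>perp w \<bullet> z\<close> is the determinant of \<open>w\<close> and
  \<open>z\<close>.\<close>

definition perp :: "real^2 \<Rightarrow> real^2" where
  "perp w = vector [- w $ 2, w $ 1]"

lemma inner_perp: "perp w \<bullet> z = w $ 1 * z $ 2 - w $ 2 * z $ 1"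
  by (simp add: perp_def inner_vec_def sum_2)

lemma inner_perp_self [simp]: "perp w \<bullet> w = 0"
  by (simp add: inner_perp)

lemma perp_eq_0_iff [simp]: "perp w = 0 \<longleftrightarrow> w = 0"
  by (auto simp: perp_def vec_eq_iff forall_2)

lemma inner_perp_eq_0:
  assumes "w \<noteq> 0" "perp w \<bullet> z = 0"
  obtains k where "z = k *\<^sub>R w"
proof (cases "w $ 1 = 0")
  case True
  then have "w $ 2 \<noteq> 0"
    using assms(1) by (auto simp: vec_eq_iff forall_2)
  then have "z = (z $ 2 / w $ 2) *\<^sub>R w"
    using True assms(2) by (simp add: inner_perp vec_eq_iff forall_2)
  then show thesis
    by (rule that)
next
  case False
  then have "z = (z $ 1 / w $ 1) *\<^sub>R w"
    using assms(2) by (simp add: inner_perp vec_eq_iff forall_2 field_simps)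
  then show thesis
    by (rule that)
qed

section \<open>Where the constant \<open>sqrt 2\<close> comes from\<close>

text \<open>The median formula bounds the sum of the squared distances by 1, and the square of a sum
  of two reals is at most twice the sum of their squares.\<close>

lemma sum_dist_le_sqrt_2_of_near_midpoint:
  fixes p q u :: "'a::real_inner"
  assumes "dist p q \<le> 1" "dist u (midpoint p q) \<le> 1/2"
  shows "dist p u + dist u q \<le> sqrt 2"
proof (rule real_le_rsqrt)
  have "(dist p u)\<^sup>2 + (dist u q)\<^sup>2 = (dist p q)\<^sup>2 / 2 + 2 * (dist u (midpoint p q))\<^sup>2"
    unfolding dist_norm power2_norm_eq_inner midpoint_def
    by (simp add: inner_diff_left inner_diff_right inner_add_left inner_add_right
        inner_commute algebra_simps add_divide_distrib diff_divide_distrib)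
  also have "\<dots> \<le> 1\<^sup>2 / 2 + 2 * (1/2)\<^sup>2"
    using assms by (intro add_mono mult_left_mono divide_right_mono power_mono) auto
  finally have "(dist p u)\<^sup>2 + (dist u q)\<^sup>2 \<le> 1"
    by (simp add: power2_eq_square)
  moreover have "0 \<le> (dist p u - dist u q)\<^sup>2"
    by simp
  ultimately show "(dist p u + dist u q)\<^sup>2 \<le> 2"
    unfolding power2_sum power2_diff by linarith
qed

text \<open>If \<open>c\<close> lies in the half of the segment at \<open>p\<close>, its distance to
  the midpoint is \<open>dist p q / 2 - dist c p\<close>; going on to \<open>u\<close> adds at most
  \<open>dist c p\<close>. The other half is symmetric.\<close>

lemma dist_midpoint_le_of_nearest_endpoint:
  fixes c :: "'a::euclidean_space"
  assumes "c \<in> closed_segment p q" "dist c u \<le> dist c p" "dist c u \<le> dist c q"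
  shows "dist u (midpoint p q) \<le> dist p q / 2"
proof -
  let ?m = "midpoint p q"
  have "c \<in> closed_segment p ?m \<or> c \<in> closed_segment ?m q"
    using assms(1) Un_closed_segment[of ?m p q] midpoint_in_closed_segment by blast
  then have "dist c ?m + dist c p = dist p q / 2 \<or> dist c ?m + dist c q = dist p q / 2"
    unfolding between_mem_segment[symmetric] between
    by (auto simp: dist_midpoint dist_commute)
  moreover have "dist u ?m \<le> dist c u + dist c ?m"
    by (rule dist_triangle3)
  ultimately show ?thesis
    using assms(2,3) by linarith
qed

section \<open>Construction of the detouring arcs\<close>

text \<open>The broken line from \<open>p\<close> to \<open>q\<close> turns at a point
  \<open>r\<close> of the line \<open>uv\<close> just outside the segment. Since \<open>p\<close>
  and \<open>q\<close> lie strictly on opposite sides of that line, each leg meets it only in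
  \<open>r\<close>.\<close>

lemma detour_beyond_endpoint:
  fixes p q u v :: "real^2"
  assumes "dist p q \<le> 1" "dist u v \<le> 1" "u \<noteq> v" "u \<noteq> p" "u \<noteq> q"
    and c: "c \<in> closed_segment p q" "c \<in> closed_segment u v"
    and near: "dist c u \<le> dist c p" "dist c u \<le> dist c q"
    and noncollinear: "\<not> collinear {p, q, u, v}"
    and "0 < e"
  obtains g where "arc g" "pathstart g = p" "pathfinish g = q" "path_len g \<le> ennreal (sqrt 2 + e)"
    "path_image g \<inter> closed_segment u v = {}"
proof -
  define n where "n = perp (v - u)"
  \<comment> \<open>\<open>f\<close> vanishes on the line \<open>uv\<close>, and its sign tells the
    two sides apart.\<close>
  define f where "f z = n \<bullet> (z - u)" for z
  \<comment> \<open>As \<open>dist u v \<le> 1\<close>, \<open>r\<close> is within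
    \<open>e / 2\<close> of \<open>u\<close>, so turning at \<open>r\<close> instead of
    \<open>u\<close> costs at most \<open>e\<close>.\<close>
  define r where "r = u + (e / 2) *\<^sub>R (u - v)"
  have fu: "f u = 0"
    by (simp add: f_def)
  have fv: "f v = 0"
    by (simp add: f_def n_def)
  have nuv: "n \<bullet> (u - v) = 0"
    using fv by (simp add: f_def inner_diff_right)
  have fr: "f r = 0"
    by (simp add: f_def r_def nuv)
  have f_uv: "f z = 0" if "z \<in> closed_segment u v" for z
    using inner_closed_segment[OF that] fu fv unfolding f_def by (metis add_0 mult_zero_right)
  have not_both: "f p \<noteq> 0 \<or> f q \<noteq> 0"
  proof (rule ccontr)
    assume "\<not> ?thesis"
    then obtain k l where "p - u = k *\<^sub>R (v - u)" "q - u = l *\<^sub>R (v - u)"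
      using inner_perp_eq_0[of "v - u"] \<open>u \<noteq> v\<close> unfolding f_def n_def
      by (metis right_minus_eq)
    then have "p = u + k *\<^sub>R (v - u)" "q = u + l *\<^sub>R (v - u)"
      "u = u + 0 *\<^sub>R (v - u)" "v = u + 1 *\<^sub>R (v - u)"
      by (auto simp: algebra_simps)
    then have "collinear {p, q, u, v}"
      unfolding collinear_alt by blast
    then show False
      using noncollinear by simp
  qed
  have fc: "f c = 0"
    using f_uv c by simp
  \<comment> \<open>Otherwise \<open>q\<close> is off the line, so \<open>pq\<close> meets the line
    only in \<open>p\<close>; then \<open>c = p\<close>, and \<open>u\<close>, being no farther from
    \<open>c\<close> than \<open>p\<close> is, would equal \<open>p\<close>.\<close>
  have fp: "f p \<noteq> 0"
  proof
    assume "f p = 0"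
    then have "c = p"
      using closed_segment_off_hyperplane[of c q p n u] c(1) fc not_both
      by (simp add: f_def closed_segment_commute)
    then show False
      using near \<open>u \<noteq> p\<close> by simp
  qed
  have fq: "f q \<noteq> 0"
  proof
    assume "f q = 0"
    then have "c = q"
      using closed_segment_off_hyperplane[of c p q n u] c(1) fc not_both
      by (simp add: f_def)
    then show False
      using near \<open>u \<noteq> q\<close> by simp
  qed
  have opposite: "f p * f q < 0"
  proof -
    obtain s where s: "0 \<le> s" "s \<le> 1" "(1 - s) * f p + s * f q = 0"
      using inner_closed_segment[OF c(1)] fc unfolding f_def by metis
    then have "s \<noteq> 0" "s \<noteq> 1"
      using fp fq by auto
    then have "0 < s" "s < 1"
      using s by auto
    \<comment> \<open>The vanishing of \<open>f\<close> at \<open>c\<close>, multiplied by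
      \<open>f p\<close>.\<close>
    have "s * (f p * f q) = - ((1 - s) * (f p)\<^sup>2)"
      using s(3) by (simp add: power2_eq_square) algebra
    also have "\<dots> < 0"
      using \<open>s < 1\<close> fp by simp
    finally show ?thesis
      using \<open>0 < s\<close> by (simp add: mult_less_0_iff)
  qed
  have "r \<notin> closed_segment u v"
  proof
    assume "r \<in> closed_segment u v"
    then have "dist u v = dist u r + dist r v"
      by (simp flip: between between_mem_segment)
    \<comment> \<open>\<open>r\<close> is farther from \<open>v\<close> than \<open>u\<close> is,
      which no point of the segment can be.\<close>
    moreover have "r - v = (1 + e / 2) *\<^sub>R (u - v)"
      by (simp add: r_def algebra_simps)
    then have "dist r v = (1 + e / 2) * dist u v"
      using \<open>0 < e\<close> by (simp add: dist_norm)
    moreover have "0 < e / 2 * dist u v"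
      using \<open>0 < e\<close> \<open>u \<noteq> v\<close> by simp
    ultimately show False
      using zero_le_dist[of u r] by (simp add: algebra_simps)
  qed
  have meets: "z = r" if "z \<in> closed_segment p r \<or> z \<in> closed_segment r q" "f z = 0" for z
    using that closed_segment_off_hyperplane[of z p r n u] closed_segment_off_hyperplane[of z q r n u]
      fp fq fr by (auto simp: f_def closed_segment_commute)
  let ?g = "linepath p r +++ linepath r q"
  have image: "path_image ?g = closed_segment p r \<union> closed_segment r q"
    by (simp add: path_image_join)
  show thesis
  proof
    have "closed_segment p r \<inter> closed_segment r q \<subseteq> {r}"
    proof
      fix z assume z: "z \<in> closed_segment p r \<inter> closed_segment r q"
      obtain s where s: "0 \<le> s" "s \<le> 1" "f z = (1 - s) * f p"
        using inner_closed_segment[of z p r] z fr unfolding f_def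
        by (metis IntD1 add.right_neutral mult_zero_right)
      obtain t where t: "0 \<le> t" "t \<le> 1" "f z = t * f q"
        using inner_closed_segment[of z r q] z fr unfolding f_def
        by (metis IntD2 add_0 mult_zero_right)
      \<comment> \<open>On one leg \<open>f z\<close> is a nonnegative multiple of
        \<open>f p\<close>, on the other of \<open>f q\<close>; opposite signs leave only
        zero.\<close>
      have "f z * f z = ((1 - s) * t) * (f p * f q)"
        using s(3) t(3) by (metis mult.assoc mult.left_commute)
      also have "\<dots> \<le> 0"
        using s(2) t(1) opposite by (intro mult_nonneg_nonpos[OF mult_nonneg_nonneg less_imp_le]) auto
      finally have "f z = 0"
        by (metis antisym mult_eq_0_iff zero_le_square)
      then show "z \<in> {r}"
        using meets z by blast
    qed
    then show "arc ?g"
      using fp fq fr by (intro arc_join_linepath) auto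
    show "pathstart ?g = p" "pathfinish ?g = q"
      by auto
    show "path_image ?g \<inter> closed_segment u v = {}"
      using meets f_uv \<open>r \<notin> closed_segment u v\<close> unfolding image by blast
    have "dist u r = e / 2 * dist u v"
      using \<open>0 < e\<close> by (simp add: r_def dist_norm)
    also have "\<dots> \<le> e / 2"
      using \<open>0 < e\<close> \<open>dist u v \<le> 1\<close> by (simp add: mult_left_le)
    finally have "dist u r \<le> e / 2" .
    moreover have "dist p u + dist u q \<le> sqrt 2"
      using dist_midpoint_le_of_nearest_endpoint[OF c(1) near] \<open>dist p q \<le> 1\<close>
      by (intro sum_dist_le_sqrt_2_of_near_midpoint) auto
    ultimately have "dist p r + dist r q \<le> sqrt 2 + e"
      using dist_triangle[of p r u] dist_triangle3[of r q u] by simp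
    then show "path_len ?g \<le> ennreal (sqrt 2 + e)"
      using path_len_join_linepath[of p r q] by (meson ennreal_leI order_trans)
  qed
qed

text \<open>Serves the collinear case, where segments may overlap: tents raised on opposite sides of
  the line touch it only at the given endpoints.\<close>

lemma tent_over_segment:
  fixes p q :: "'a::real_inner"
  assumes "p \<noteq> q" "dist p q \<le> 1" "n \<bullet> (p - a) = 0" "n \<bullet> (q - a) = 0" "n \<noteq> 0" "0 < e"
  obtains g where "arc g" "pathstart g = p" "pathfinish g = q" "path_len g \<le> ennreal (1 + e)"
    "\<And>z. z \<in> path_image g \<Longrightarrow> z = p \<or> z = q \<or> 0 < n \<bullet> (z - a)"
proof -
  \<comment> \<open>Raising the midpoint by \<open>e / 2\<close> lengthens each of the two halves by
    at most \<open>e / 2\<close>.\<close>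
  define w where "w = (e / 2) *\<^sub>R (n /\<^sub>R norm n)"
  define r where "r = midpoint p q + w"
  define f where "f z = n \<bullet> (z - a)" for z
  have fp: "f p = 0" and fq: "f q = 0"
    using assms by (auto simp: f_def)
  have "f (midpoint p q) = (f p + f q) / 2"
    unfolding f_def midpoint_def by (simp add: inner_diff_right inner_add_right field_simps)
  then have "f r = n \<bullet> w"
    using fp fq by (simp add: f_def r_def inner_diff_right inner_add_right)
  also have "\<dots> > 0"
    using assms by (simp add: w_def)
  finally have fr: "0 < f r" .
  let ?g = "linepath p r +++ linepath r q"
  have image: "path_image ?g = closed_segment p r \<union> closed_segment r q"
    by (simp add: path_image_join)
  show thesis
  proof
    have "closed_segment p r \<inter> closed_segment r q \<subseteq> {r}"
    proof
      fix z assume z: "z \<in> closed_segment p r \<inter> closed_segment r q"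
      obtain s where s: "z = (1 - s) *\<^sub>R p + s *\<^sub>R r" "f z = s * f r"
        using inner_closed_segment[of z p r] z fp unfolding f_def
        by (metis IntD1 add_0 mult_zero_right)
      obtain t where t: "z = (1 - t) *\<^sub>R r + t *\<^sub>R q" "f z = (1 - t) * f r"
        using inner_closed_segment[of z r q] z fq unfolding f_def
        by (metis IntD2 add.right_neutral mult_zero_right)
      \<comment> \<open>Equal heights over the line give equal weights of the apex, so its
        contributions cancel and only the weights of \<open>p\<close> and \<open>q\<close> remain to
        be compared.\<close>
      have "t = 1 - s"
        using s(2) t(2) fr by simp
      then have "(1 - s) *\<^sub>R p = (1 - s) *\<^sub>R q"
        using s(1) t(1) by force
      then have "s = 1"
        using \<open>p \<noteq> q\<close> by simp
      then show "z \<in> {r}"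
        using s(1) by simp
    qed
    then show "arc ?g"
      using fp fq fr by (intro arc_join_linepath) auto
    show "pathstart ?g = p" "pathfinish ?g = q"
      by auto
    show "z = p \<or> z = q \<or> 0 < n \<bullet> (z - a)" if "z \<in> path_image ?g" for z
    proof -
      have "z = b \<or> 0 < f z" if z: "z \<in> closed_segment b r" and fb: "f b = 0" for b
      proof -
        obtain s where s: "0 \<le> s" "z = (1 - s) *\<^sub>R b + s *\<^sub>R r" "f z = s * f r"
          using inner_closed_segment[OF z] fb unfolding f_def
          by (metis add_0 mult_zero_right)
        then show ?thesis
          using fr by (cases "s = 0") auto
      qed
      from this[of p] this[of q] show ?thesis
        using that fp fq unfolding image f_def by (auto simp: closed_segment_commute)
    qed
    have "norm w = e / 2"
      using assms by (simp add: w_def)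
    then have "dist (midpoint p q) r = e / 2"
      by (simp add: r_def dist_norm)
    then have "dist p r + dist r q \<le> 1 + e"
      using dist_triangle[of p r "midpoint p q"] dist_triangle3[of r q "midpoint p q"] assms(2)
      by (simp add: dist_midpoint)
    then show "path_len ?g \<le> ennreal (1 + e)"
      using path_len_join_linepath[of p r q] by (meson ennreal_leI order_trans)
  qed
qed

lemma linkage_len_2_upper:
  assumes "(x, y) \<in> admissible_pairs 2" "0 < e"
  shows "linkage_len 2 x y \<le> ennreal (sqrt 2 + e)"
proof -
  have ivl: "{1..2} = {1, 2::nat}"
    by auto
  have distinct: "x 1 \<noteq> x 2" "y 1 \<noteq> y 2" "x 1 \<noteq> y 1" "x 1 \<noteq> y 2" "x 2 \<noteq> y 1" "x 2 \<noteq> y 2"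
    and dist: "dist (x 1) (y 1) \<le> 1" "dist (x 2) (y 2) \<le> 1"
    using assms(1) unfolding admissible_pairs_def ivl by (auto simp: dist_norm)
  have line: "path_len (linepath a b) \<le> ennreal (sqrt 2 + e)" if "dist a b \<le> 1" for a b :: "real^2"
  proof -
    have "dist a b \<le> sqrt 2 + e"
      using that \<open>0 < e\<close> real_sqrt_ge_one[of 2] by linarith
    then show ?thesis
      using path_len_linepath[of a b] by (meson ennreal_leI order_trans)
  qed
  consider (disjoint) "closed_segment (x 1) (y 1) \<inter> closed_segment (x 2) (y 2) = {}"
    | (collinear) "collinear {x 1, y 1, x 2, y 2}"
    | (meet) c where "c \<in> closed_segment (x 1) (y 1)" "c \<in> closed_segment (x 2) (y 2)"
        "\<not> collinear {x 1, y 1, x 2, y 2}"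
    by blast
  then show ?thesis
  proof cases
    case disjoint
    show ?thesis
      using disjoint distinct
      by (intro linkage_len_2_le[of "linepath (x 1) (y 1)" _ _ _ "linepath (x 2) (y 2)"] line dist) auto
  next
    case collinear
    then obtain a w where aw: "\<And>z. z \<in> {x 1, y 1, x 2, y 2} \<Longrightarrow> \<exists>k. z = a + k *\<^sub>R w"
      unfolding collinear_alt by blast
    have "w \<noteq> 0"
      using aw[of "x 1"] aw[of "y 1"] distinct by auto
    define n where "n = perp w"
    have on_line: "n \<bullet> (z - a) = 0" if "z \<in> {x 1, y 1, x 2, y 2}" for z
      using aw[OF that] by (auto simp: n_def)
    have "n \<noteq> 0"
      using \<open>w \<noteq> 0\<close> by (simp add: n_def)
    obtain g where g: "arc g" "pathstart g = x 1" "pathfinish g = y 1" "path_len g \<le> ennreal (1 + e)"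
      "\<And>z. z \<in> path_image g \<Longrightarrow> z = x 1 \<or> z = y 1 \<or> 0 < n \<bullet> (z - a)"
      using tent_over_segment[of "x 1" "y 1" n a e] distinct dist on_line \<open>n \<noteq> 0\<close> \<open>0 < e\<close> by blast
    \<comment> \<open>The second tent uses the opposite normal \<open>- n\<close>, so the tents can
      share only endpoints, and these are distinct.\<close>
    obtain h where h: "arc h" "pathstart h = x 2" "pathfinish h = y 2" "path_len h \<le> ennreal (1 + e)"
      "\<And>z. z \<in> path_image h \<Longrightarrow> z = x 2 \<or> z = y 2 \<or> 0 < (- n) \<bullet> (z - a)"
      using tent_over_segment[of "x 2" "y 2" "- n" a e] distinct dist on_line \<open>n \<noteq> 0\<close> \<open>0 < e\<close>
      by auto
    have "ennreal (1 + e) \<le> ennreal (sqrt 2 + e)"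
      by (intro ennreal_leI) simp
    moreover have "path_image g \<inter> path_image h = {}"
    proof -
      have "False" if "z \<in> path_image g" "z \<in> path_image h" for z
        using g(5)[OF that(1)] h(5)[OF that(2)] on_line[of "x 1"] on_line[of "y 1"]
          on_line[of "x 2"] on_line[of "y 2"] distinct by auto
      then show ?thesis
        by blast
    qed
    ultimately show ?thesis
      using g h by (intro linkage_len_2_le[of g _ _ _ h]) (auto intro: order_trans)
  next
    case meet
    \<comment> \<open>The nearest endpoint belongs to the second pair: the second arc stays straight
      and the first makes the detour. \<open>second\<close> exchanges the roles.\<close>
    have first: ?thesis
      if uv: "u = x 2 \<and> v = y 2 \<or> u = y 2 \<and> v = x 2"
        and near: "dist c u \<le> dist c (x 1)" "dist c u \<le> dist c (y 1)" for u v
    proof -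
      have "closed_segment u v = closed_segment (x 2) (y 2)" "dist u v \<le> 1" "u \<noteq> v"
        "u \<noteq> x 1" "u \<noteq> y 1" "{x 1, y 1, u, v} = {x 1, y 1, x 2, y 2}"
        using uv distinct dist by (auto simp: closed_segment_commute dist_commute)
      then obtain g where "arc g" "pathstart g = x 1" "pathfinish g = y 1"
        "path_len g \<le> ennreal (sqrt 2 + e)" "path_image g \<inter> closed_segment (x 2) (y 2) = {}"
        using detour_beyond_endpoint[of "x 1" "y 1" u v c e] meet near dist \<open>0 < e\<close> by metis
      then show ?thesis
        using distinct line[OF dist(2)]
        by (intro linkage_len_2_le[of g _ _ _ "linepath (x 2) (y 2)"]) auto
    qed
    have second: ?thesis
      if uv: "u = x 1 \<and> v = y 1 \<or> u = y 1 \<and> v = x 1"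
        and near: "dist c u \<le> dist c (x 2)" "dist c u \<le> dist c (y 2)" for u v
    proof -
      have "closed_segment u v = closed_segment (x 1) (y 1)" "dist u v \<le> 1" "u \<noteq> v"
        "u \<noteq> x 2" "u \<noteq> y 2" "{x 2, y 2, u, v} = {x 1, y 1, x 2, y 2}"
        using uv distinct dist by (auto simp: closed_segment_commute dist_commute)
      then obtain h where "arc h" "pathstart h = x 2" "pathfinish h = y 2"
        "path_len h \<le> ennreal (sqrt 2 + e)" "path_image h \<inter> closed_segment (x 1) (y 1) = {}"
        using detour_beyond_endpoint[of "x 2" "y 2" u v c e] meet near dist \<open>0 < e\<close> by metis
      then show ?thesis
        using distinct line[OF dist(1)]
        by (intro linkage_len_2_le[of "linepath (x 1) (y 1)" _ _ _ h]) auto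
    qed
    show ?thesis
      \<comment> \<open>Whichever of the four endpoints is nearest to \<open>c\<close> satisfies the
        hypotheses of one of these instances.\<close>
      using first[of "x 2" "y 2"] first[of "y 2" "x 2"] second[of "x 1" "y 1"] second[of "y 1" "x 1"]
      by argo
  qed
qed

lemma linkage_const_2_le: "linkage_const 2 \<le> ennreal (sqrt 2)"
proof (rule ennreal_le_epsilon)
  fix e :: real assume "0 < e"
  then have "linkage_const 2 \<le> ennreal (sqrt 2 + e)"
    unfolding linkage_const_def using linkage_len_2_upper by (auto intro!: SUP_least)
  then show "linkage_const 2 \<le> ennreal (sqrt 2) + ennreal e"
    using \<open>0 < e\<close> by (simp add: ennreal_plus)
qed

section \<open>Lower bound for two pairs\<close>

text \<open>Reflecting one of the two focal radii turns the sum into the length of \<open>(1, 2t)\<close>.\<close>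

lemma ellipse_bounds:
  fixes s t :: real
  assumes "sqrt ((s + 1/2)\<^sup>2 + t\<^sup>2) + sqrt ((s - 1/2)\<^sup>2 + t\<^sup>2) < sqrt 2"
  shows "\<bar>t\<bar> < 1/2" "\<bar>s\<bar> < 1"
proof -
  have "sqrt (((s + 1/2) + (1/2 - s))\<^sup>2 + (t + t)\<^sup>2)
      \<le> sqrt ((s + 1/2)\<^sup>2 + t\<^sup>2) + sqrt ((1/2 - s)\<^sup>2 + t\<^sup>2)"
    by (rule real_sqrt_sum_squares_triangle_ineq)
  also have "\<dots> < sqrt 2"
    using assms by (simp add: power2_commute)
  finally have "t\<^sup>2 < (1/2)\<^sup>2"
    by (simp add: power2_eq_square)
  then show "\<bar>t\<bar> < 1/2"
    by (metis abs_of_pos power2_less_imp_less abs_ge_zero half_gt_zero_iff power2_abs zero_less_one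
        less_imp_le)
  \<comment> \<open>Each focal radius is at least its component along the major axis, and these
    components add up to at least \<open>2 * \<bar>s\<bar>\<close>.\<close>
  have "\<bar>s + 1/2\<bar> + \<bar>s - 1/2\<bar> < sqrt 2"
    using assms real_sqrt_ge_abs1[of "s + 1/2" t] real_sqrt_ge_abs1[of "s - 1/2" t] by linarith
  moreover have "sqrt 2 < 2"
    by (simp add: sqrt2_less_2)
  ultimately show "\<bar>s\<bar> < 1"
    by linarith
qed

lemma norm_real_2: "norm (z :: real^2) = sqrt ((z $ 1)\<^sup>2 + (z $ 2)\<^sup>2)"
  by (simp add: norm_vec_def L2_set_def sum_2)

lemma path_len_point_sum_less:
  assumes "path_len g < ennreal r" "z \<in> path_image g"
  shows "dist (pathstart g) z + dist z (pathfinish g) < r"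
proof -
  obtain t where "t \<in> {0..1}" "z = g t"
    using assms(2) by (auto simp: path_image_def)
  then have "ennreal (dist (pathstart g) z + dist z (pathfinish g)) \<le> path_len g"
    using path_len_ge_dist_through[of t g] by (simp add: pathstart_def pathfinish_def)
  then show ?thesis
    using assms(1) by (meson add_nonneg_nonneg ennreal_less_iff le_less_trans zero_le_dist)
qed

lemma crossing_paths_meet:
  fixes g h :: "real \<Rightarrow> real^2"
  assumes "path g" "pathstart g = vector [-1/2, 0]" "pathfinish g = vector [1/2, 0]"
    and "path h" "pathstart h = vector [0, -1/2]" "pathfinish h = vector [0, 1/2]"
    and len: "path_len g < ennreal (sqrt 2)" "path_len h < ennreal (sqrt 2)"
  shows "path_image g \<inter> path_image h \<noteq> {}"
proof -
  \<comment> \<open>For foci at distance 1 and distance sum \<open>sqrt 2\<close> the semi-minor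
    axis is exactly \<open>1/2\<close>, half of the other segment.\<close>
  have g: "\<bar>z $ 2\<bar> < 1/2" "\<bar>z $ 1\<bar> < 1" if "z \<in> path_image g" for z
    using path_len_point_sum_less[OF len(1) that] ellipse_bounds[of "z $ 1" "z $ 2"] assms(2,3)
    by (auto simp: dist_norm norm_real_2 power2_commute algebra_simps)
  have h: "\<bar>z $ 1\<bar> < 1/2" "\<bar>z $ 2\<bar> < 1" if "z \<in> path_image h" for z
    using path_len_point_sum_less[OF len(2) that] ellipse_bounds[of "z $ 2" "z $ 1"] assms(5,6)
    by (auto simp: dist_norm norm_real_2 power2_commute algebra_simps)
  let ?L = "linepath (vector [-1, 0]) (vector [-1/2, 0]) :: real \<Rightarrow> real^2"
  let ?R = "linepath (vector [1/2, 0]) (vector [1, 0]) :: real \<Rightarrow> real^2"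
  let ?D = "linepath (vector [0, -1]) (vector [0, -1/2]) :: real \<Rightarrow> real^2"
  let ?U = "linepath (vector [0, 1/2]) (vector [0, 1]) :: real \<Rightarrow> real^2"
  let ?G = "?L +++ g +++ ?R" and ?H = "?D +++ h +++ ?U"
  have L: "z $ 2 = 0 \<and> -1 \<le> z $ 1 \<and> z $ 1 \<le> -1/2" if "z \<in> path_image ?L" for z
    using that by (auto simp: in_segment; simp add: field_simps)
  have R: "z $ 2 = 0 \<and> 1/2 \<le> z $ 1 \<and> z $ 1 \<le> 1" if "z \<in> path_image ?R" for z
    using that by (auto simp: in_segment; simp add: field_simps)
  have D: "z $ 1 = 0 \<and> -1 \<le> z $ 2 \<and> z $ 2 \<le> -1/2" if "z \<in> path_image ?D" for z
    using that by (auto simp: in_segment; simp add: field_simps)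
  have U: "z $ 1 = 0 \<and> 1/2 \<le> z $ 2 \<and> z $ 2 \<le> 1" if "z \<in> path_image ?U" for z
    using that by (auto simp: in_segment; simp add: field_simps)
  have imG: "path_image ?G = path_image ?L \<union> path_image g \<union> path_image ?R"
    using assms by (simp add: path_image_join Un_assoc)
  have imH: "path_image ?H = path_image ?D \<union> path_image h \<union> path_image ?U"
    using assms by (simp add: path_image_join Un_assoc)
  obtain z where z: "z \<in> path_image ?G" "z \<in> path_image ?H"
  \<comment> \<open>The prolonged paths join opposite sides of the square with corners
    \<open>-1\<close> and \<open>1\<close>.\<close>
  proof (rule fashoda_unit_path[of ?G ?H])
    show "path ?G" "path ?H"
      using assms by auto
    show "path_image ?G \<subseteq> cbox (-1) 1"
      using L R g unfolding imG by (fastforce simp: mem_box_cart forall_2)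
    show "path_image ?H \<subseteq> cbox (-1) 1"
      using D U h unfolding imH by (fastforce simp: mem_box_cart forall_2)
  qed auto
  \<comment> \<open>No added piece contains the meeting point: \<open>g\<close> stays below height
    \<open>1/2\<close> in absolute value, where \<open>?D\<close> and \<open>?U\<close> begin;
    likewise \<open>h\<close> misses \<open>?L\<close> and \<open>?R\<close>; and the added pieces
    lie on different axes away from the origin.\<close>
  then have "z \<in> path_image g" "z \<in> path_image h"
    using L[of z] R[of z] D[of z] U[of z] g[of z] h[of z] unfolding imG imH by auto
  then show ?thesis
    by blast
qed

lemma linkage_const_2_ge: "ennreal (sqrt 2) \<le> linkage_const 2"
proof -
  define x :: "nat \<Rightarrow> real^2" where "x i = (if i = 1 then vector [-1/2, 0] else vector [0, -1/2])" for i
  define y :: "nat \<Rightarrow> real^2" where "y i = (if i = 1 then vector [1/2, 0] else vector [0, 1/2])" for i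
  have ivl: "{1..2} = {1, 2::nat}"
    by auto
  have "(x, y) \<in> admissible_pairs 2"
    unfolding admissible_pairs_def ivl
    by (auto simp: x_def y_def vec_eq_iff forall_2 norm_real_2)
  moreover have "ennreal (sqrt 2) \<le> linkage_len 2 x y"
    unfolding linkage_len_def
  proof (rule INF_greatest)
    fix \<gamma> assume "\<gamma> \<in> linkages 2 x y"
    then have \<gamma>: "path (\<gamma> 1)" "pathstart (\<gamma> 1) = vector [-1/2, 0]" "pathfinish (\<gamma> 1) = vector [1/2, 0]"
      "path (\<gamma> 2)" "pathstart (\<gamma> 2) = vector [0, -1/2]" "pathfinish (\<gamma> 2) = vector [0, 1/2]"
      "path_image (\<gamma> 1) \<inter> path_image (\<gamma> 2) = {}"
      unfolding linkages_def ivl by (auto simp: x_def y_def disjoint_family_on_def arc_imp_path)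
    then have "ennreal (sqrt 2) \<le> path_len (\<gamma> 1) \<or> ennreal (sqrt 2) \<le> path_len (\<gamma> 2)"
      using crossing_paths_meet[of "\<gamma> 1" "\<gamma> 2"] by (meson not_le)
    then show "ennreal (sqrt 2) \<le> Max ((\<lambda>i. path_len (\<gamma> i)) ` {1..2})"
      unfolding ivl by (simp add: le_max_iff_disj)
  qed
  ultimately show ?thesis
    unfolding linkage_const_def by (intro SUP_upper2[where i = "(x, y)"]) auto
qed

theorem mainTheorem3:
  shows "(\<forall>n\<ge>1. linkage_const (n + 1) \<ge> linkage_const n) \<and>
    linkage_const 3 \<ge> linkage_const 2 \<and>
    linkage_const 2 = ennreal (sqrt 2) \<and>
    sqrt 2 > (sqrt 3 + 1) / 2 \<and>
    linkage_const 3 \<noteq> ennreal ((sqrt 3 + 1) / 2)"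
proof -
  have mono: "\<forall>n\<ge>1. linkage_const (n + 1) \<ge> linkage_const n"
    using linkage_const_Suc_ge by blast
  have C3: "linkage_const 3 \<ge> linkage_const 2"
    using linkage_const_Suc_ge[of 2] by simp
  have C2: "linkage_const 2 = ennreal (sqrt 2)"
    using linkage_const_2_le linkage_const_2_ge by (rule antisym)
  have "sqrt 3 < 2"
    by (rule real_less_lsqrt) auto
  \<comment> \<open>The square equals \<open>1 + sqrt 3 / 2\<close>.\<close>
  then have "((sqrt 3 + 1) / 2)\<^sup>2 < 2"
    by (simp add: power_divide power2_sum)
  then have less: "(sqrt 3 + 1) / 2 < sqrt 2"
    by (rule real_less_rsqrt)
  then have "ennreal ((sqrt 3 + 1) / 2) < linkage_const 3"
    using C3 unfolding C2 by (intro less_le_trans[OF ennreal_lessI]) auto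
  then show ?thesis
    using mono C3 C2 less by auto
qed

end
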